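(* Let $S$ be a choice function on $\mathcal F(\Delta)$. There exists a continuous and convex preference relation $\succ$ on $\Delta$ such that $S(X)=\max_\succ(X)$ for every $X\in\mathcal F(\Delta)$ if and only if $S$ is consistent, i.e., satisfies both contraction and expansion.
   Context: $\mathcal U$ is a non-empty finite set and $\Delta$ is the set of all probability measures on $\mathcal U$, with the Euclidean topology (and norm) inherited from $\mathbb R^{\mathcal U}$. For $p,q\in\Delta$, $[p,q]=\mathrm{conv}(\{p,q\})$. A preference relation is an asymmetric binary relation $\succ$ on $\Delta$; $p\sim q$ means neither $p\succ q$ nor $q\succ p$; $p\succsim q$ means $p\succ q$ or $p\sim q$. Let $U(p)=\{q\in\Delta: q\succ p\}$, $L(p)=\{q\in\Delta: p\succ q\}$, $I(p)=\{q\in\Delta: p\sim q\}$. The relation is continuous if $U(p)$ and $L(p)$ are open in $\Delta$ for all $p$, and convex if $U(p)$, $L(p)$, $U(p)\cup I(p)$ and $L(p)\cup I(p)$ are convex for all $p$. $\mathcal F(\Delta)$ is the set of all non-empty, compact, convex subsets of $\Delta$ (feasible sets), equipped with the Hausdorff distance. $\max_\succ(X)=\{x\in X: x\succsim y\text{ for all }y\in X\}$. A choice function is a map $S\colon\mathcal F(\Delta)\to\mathcal F(\Delta)$ such that: $S(X)\subseteq X$ for all $X$; $S([p,q])\in\{\{p\},\{q\},[p,q]\}$ for all $p,q\in\Delta$; and $S$ is upper hemi-continuous, i.e., whenever $X_i\to X$ in $\mathcal F(\Delta)$ (Hausdorff distance), $p_i\in S(X_i)$ for all $i\in\mathbb N$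 and $p_i\to p\in\Delta$, then $p\in S(X)$. $S$ satisfies contraction if $S(X)\cap Y\subseteq S(X\cap Y)$ for all $X,Y\in\mathcal F(\Delta)$ with $X\cap Y\ne\emptyset$. $S$ satisfies expansion if $S(X)\cap S(Y)\subseteq S(\mathrm{conv}(X\cup Y))$ for all $X,Y\in\mathcal F(\Delta)$. *)

theory Defs
  imports "HOL-Analysis.Analysis"
begin

(* A probability measure on the finite non-empty type 'u is identified with its vector of
   point masses, so that topology and norm are those of Euclidean space. *)
definition prob_simplex :: "(real ^ 'u::finite) set" where
  "prob_simplex = {p. (\<forall>i. 0 \<le> p $ i) \<and> (\<Sum>i\<in>UNIV. p $ i) = 1}"

definition feasible :: "(real ^ 'u::finite) set set" where
  "feasible = {X. X \<subseteq> prob_simplex \<and> X \<noteq> {} \<and> compact X \<and> convex X}"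

(* The suprema are those of bounded non-empty sets of reals as long as X and Y are
   bounded and non-empty; only such arguments are used below. *)
definition hausdorff_dist :: "'a::metric_space set \<Rightarrow> 'a set \<Rightarrow> real" where
  "hausdorff_dist X Y = max (SUP x\<in>X. infdist x Y) (SUP y\<in>Y. infdist y X)"

definition preference_relation :: "(real ^ 'u::finite \<Rightarrow> real ^ 'u \<Rightarrow> bool) \<Rightarrow> bool" where
  "preference_relation R \<longleftrightarrow>
     (\<forall>p q. R p q \<longrightarrow> p \<in> prob_simplex \<and> q \<in> prob_simplex) \<and> asymp R"

definition indiff :: "('a \<Rightarrow> 'a \<Rightarrow> bool) \<Rightarrow> 'a \<Rightarrow> 'a \<Rightarrow> bool" where
  "indiff R p q \<longleftrightarrow> \<not> R p q \<and> \<not> R q p"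

definition weak_pref :: "('a \<Rightarrow> 'a \<Rightarrow> bool) \<Rightarrow> 'a \<Rightarrow> 'a \<Rightarrow> bool" where
  "weak_pref R p q \<longleftrightarrow> R p q \<or> indiff R p q"

definition upper_set :: "(real ^ 'u::finite \<Rightarrow> real ^ 'u \<Rightarrow> bool) \<Rightarrow> real ^ 'u \<Rightarrow> (real ^ 'u) set" where
  "upper_set R p = {q \<in> prob_simplex. R q p}"

definition lower_set :: "(real ^ 'u::finite \<Rightarrow> real ^ 'u \<Rightarrow> bool) \<Rightarrow> real ^ 'u \<Rightarrow> (real ^ 'u) set" where
  "lower_set R p = {q \<in> prob_simplex. R p q}"

definition indiff_set :: "(real ^ 'u::finite \<Rightarrow> real ^ 'u \<Rightarrow> bool) \<Rightarrow> real ^ 'u \<Rightarrow> (real ^ 'u) set" where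
  "indiff_set R p = {q \<in> prob_simplex. indiff R p q}"

definition continuous_pref :: "(real ^ 'u::finite \<Rightarrow> real ^ 'u \<Rightarrow> bool) \<Rightarrow> bool" where
  "continuous_pref R \<longleftrightarrow>
     (\<forall>p\<in>prob_simplex. openin (top_of_set prob_simplex) (upper_set R p) \<and>
                       openin (top_of_set prob_simplex) (lower_set R p))"

definition convex_pref :: "(real ^ 'u::finite \<Rightarrow> real ^ 'u \<Rightarrow> bool) \<Rightarrow> bool" where
  "convex_pref R \<longleftrightarrow>
     (\<forall>p\<in>prob_simplex. convex (upper_set R p) \<and> convex (lower_set R p) \<and>
                       convex (upper_set R p \<union> indiff_set R p) \<and>
                       convex (lower_set R p \<union> indiff_set R p))"

definition max_set :: "('a \<Rightarrow> 'a \<Rightarrow> bool) \<Rightarrow> 'a set \<Rightarrow> 'a set" where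
  "max_set R X = {x \<in> X. \<forall>y\<in>X. weak_pref R x y}"

definition upper_hemicontinuous :: "((real ^ 'u::finite) set \<Rightarrow> (real ^ 'u) set) \<Rightarrow> bool" where
  "upper_hemicontinuous S \<longleftrightarrow>
     (\<forall>(X :: nat \<Rightarrow> (real ^ 'u) set) Y (p :: nat \<Rightarrow> real ^ 'u) q.
        (\<forall>i. X i \<in> feasible) \<and> Y \<in> feasible \<and>
        (\<lambda>i. hausdorff_dist (X i) Y) \<longlonglongrightarrow> 0 \<and>
        (\<forall>i. p i \<in> S (X i)) \<and> q \<in> prob_simplex \<and> p \<longlonglongrightarrow> q
        \<longrightarrow> q \<in> S Y)"

(* Only the values of S on feasible sets matter, here and in the notions below. *)
definition choice_function :: "((real ^ 'u::finite) set \<Rightarrow> (real ^ 'u) set) \<Rightarrow> bool" where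
  "choice_function S \<longleftrightarrow>
     (\<forall>X\<in>feasible. S X \<in> feasible \<and> S X \<subseteq> X) \<and>
     (\<forall>p\<in>prob_simplex. \<forall>q\<in>prob_simplex.
        S (convex hull {p, q}) \<in> {{p}, {q}, convex hull {p, q}}) \<and>
     upper_hemicontinuous S"

definition contraction :: "((real ^ 'u::finite) set \<Rightarrow> (real ^ 'u) set) \<Rightarrow> bool" where
  "contraction S \<longleftrightarrow>
     (\<forall>X\<in>feasible. \<forall>Y\<in>feasible. X \<inter> Y \<noteq> {} \<longrightarrow> S X \<inter> Y \<subseteq> S (X \<inter> Y))"

definition expansion :: "((real ^ 'u::finite) set \<Rightarrow> (real ^ 'u) set) \<Rightarrow> bool" where
  "expansion S \<longleftrightarrow>
     (\<forall>X\<in>feasible. \<forall>Y\<in>feasible. S X \<inter> S Y \<subseteq> S (convex hull (X \<union> Y)))"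

definition consistent :: "((real ^ 'u::finite) set \<Rightarrow> (real ^ 'u) set) \<Rightarrow> bool" where
  "consistent S \<longleftrightarrow> contraction S \<and> expansion S"

end

(* Write W a b for "a is chosen from the segment [a, b]".  Expansion and contraction show that
   S X consists of the W-maximal points of X: p is chosen from every polytope spanned by p and
   finitely many points it weakly beats, and upper hemicontinuity passes to the limit.  The work
   lies in the convexity of the contour sets, of which only {x. W p x} is convex at once.  The
   engine is the restriction on segments: a point that is maximal in a segment but not an endpoint
   of it is indifferent to the whole segment.  Hence a point that is maximal in a triangle cannot
   lie strictly between a point of the triangle that it strictly beats and another
   one.  Each failure of convexity produces such a point. *)

theory Submission
  imports Defs
begin

section \<open>Affine coordinates in a triangle and points on segments\<close>

text \<open>Affine coordinates with origin \<open>p\<close>. They may be negative or exceed 1, and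
  the three points may be collinear, so incidences can be checked on coordinates alone.\<close>

definition tri :: "'a::real_vector \<Rightarrow> 'a \<Rightarrow> 'a \<Rightarrow> real \<Rightarrow> real \<Rightarrow> 'a" where
  "tri p q r \<alpha> \<beta> = p + \<alpha> *\<^sub>R (q - p) + \<beta> *\<^sub>R (r - p)"

lemma tri_vertices [simp]:
  "tri p q r 0 0 = p" "tri p q r 1 0 = q" "tri p q r 0 1 = r"
  by (simp_all add: tri_def)

lemma tri_swap: "tri p r q \<beta> \<alpha> = tri p q r \<alpha> \<beta>"
  by (simp add: tri_def)

lemma tri_affine:
  assumes "a = \<alpha> * a1 + \<beta> * a2 + (1 - \<alpha> - \<beta>) * a3" "b = \<alpha> * b1 + \<beta> * b2 + (1 - \<alpha> - \<beta>) * b3"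
  shows "tri p q r a b =
    \<alpha> *\<^sub>R tri p q r a1 b1 + \<beta> *\<^sub>R tri p q r a2 b2 + (1 - \<alpha> - \<beta>) *\<^sub>R tri p q r a3 b3"
  unfolding assms tri_def by (simp add: algebra_simps)

lemma tri_convex_comb:
  assumes "a = (1 - u) * a1 + u * a2" "b = (1 - u) * b1 + u * b2"
  shows "tri p q r a b = (1 - u) *\<^sub>R tri p q r a1 b1 + u *\<^sub>R tri p q r a2 b2"
  unfolding assms tri_def by (simp add: algebra_simps)

lemma tri_in_segment:
  assumes "0 \<le> u" "u \<le> 1" "a = (1 - u) * a1 + u * a2" "b = (1 - u) * b1 + u * b2"
  shows "tri p q r a b \<in> closed_segment (tri p q r a1 b1) (tri p q r a2 b2)"
  using assms tri_convex_comb[OF assms(3,4)] by (auto simp: in_segment)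

lemma tri_in_convex:
  assumes "convex D" "p \<in> D" "q \<in> D" "r \<in> D" "0 \<le> a" "0 \<le> b" "a + b \<le> 1"
  shows "tri p q r a b \<in> D"
proof -
  have eq: "tri p q r a b = (1 - a - b) *\<^sub>R p + a *\<^sub>R q + b *\<^sub>R r"
    by (simp add: tri_def algebra_simps)
  have "convex hull {p, q, r} \<subseteq> D" using assms by (simp add: hull_minimal)
  moreover have "tri p q r a b \<in> convex hull {p, q, r}"
    unfolding convex_hull_3 eq using assms by (intro CollectI exI[of _ "1-a-b"] exI[of _ a] exI[of _ b]) auto
  ultimately show ?thesis by blast
qed

lemma closed_segment_tri:
  assumes "s \<in> closed_segment q r"
  obtains m where "0 \<le> m" "m \<le> 1" "s = tri p q r (1 - m) m"
proof -
  obtain m where "0 \<le> m" "m \<le> 1" "s = (1 - m) *\<^sub>R q + m *\<^sub>R r" using assms by (auto simp: in_segment)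
  moreover have "(1 - m) *\<^sub>R q + m *\<^sub>R r = tri p q r (1 - m) m"
    by (simp add: tri_def algebra_simps)
  ultimately show ?thesis using that by metis
qed

lemma tri_tendsto [tendsto_intros]:
  fixes p :: "'a::real_normed_vector"
  assumes "(f \<longlongrightarrow> a) F" "(g \<longlongrightarrow> b) F"
  shows "((\<lambda>x. tri p q r (f x) (g x)) \<longlongrightarrow> tri p q r a b) F"
  unfolding tri_def by (intro tendsto_intros assms)

lemma closed_segment_nested:
  fixes t :: "'a::real_vector"
  assumes "t \<in> closed_segment p r" "y \<in> closed_segment t r"
  shows "t \<in> closed_segment p y"
proof -
  obtain u where u: "0 \<le> u" "u \<le> 1" "t = (1 - u) *\<^sub>R p + u *\<^sub>R r" using assms by (auto simp: in_segment)
  obtain v where v: "0 \<le> v" "v \<le> 1" "y = (1 - v) *\<^sub>R t + v *\<^sub>R r" using assms by (auto simp: in_segment)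
  show ?thesis
  proof (cases "u = 0")
    case False
    \<comment> \<open>\<open>d\<close> is the parameter of \<open>y\<close> on the segment from
      \<open>p\<close> to \<open>r\<close>, so \<open>t\<close> has parameter \<open>u / d\<close>
      on the segment from \<open>p\<close> to \<open>y\<close>.\<close>
    define d where "d = u + v * (1 - u)"
    have d: "u \<le> d" "d > 0" unfolding d_def using u v False by (auto intro: add_pos_nonneg)
    have y: "y = (1 - d) *\<^sub>R p + d *\<^sub>R r" unfolding v(3) u(3) d_def by (simp add: algebra_simps)
    have "t = (1 - u / d) *\<^sub>R p + (u / d) *\<^sub>R y"
      using d unfolding y u(3) by (simp add: algebra_simps)
    then show ?thesis unfolding in_segment using d u by (intro exI[of _ "u / d"]) auto
  qed (use u in simp)
qed

text \<open>The fraction is the first coordinate of the projection of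
  \<open>tri p q r (x * (1 - m)) (x * m)\<close> from \<open>r\<close> onto the side from
  \<open>p\<close> to \<open>q\<close>. Replacing \<open>m\<close> by \<open>1 - m\<close> gives the
  projection from \<open>q\<close> onto the side from \<open>p\<close> to \<open>r\<close>.\<close>

lemma projection_coefficient:
  fixes x m :: real
  assumes "0 < x" "x < 1" "0 < m" "m < 1"
  shows "x * m < 1" "0 < x * (1 - m) / (1 - x * m)" "x * (1 - m) / (1 - x * m) \<le> 1"
    "x * (1 - m) / (1 - x * m) * (1 - x * m) = x * (1 - m)"
proof -
  show "x * m < 1" using assms mult_strict_mono[of x 1 m 1] by simp
  then have "0 < 1 - x * m" by simp
  moreover have "x * (1 - m) \<le> 1 - x * m" using assms by (simp add: algebra_simps)
  ultimately show "0 < x * (1 - m) / (1 - x * m)" "x * (1 - m) / (1 - x * m) \<le> 1"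
    "x * (1 - m) / (1 - x * m) * (1 - x * m) = x * (1 - m)"
    using assms by (simp_all add: divide_simps)
qed

section \<open>An abstract weak preference and its behaviour on segments\<close>

text \<open>The axioms isolate what the geometry uses of the weak preference \<open>W\<close>;
  transitivity is not among them. \<open>flat_upper\<close> reflects that choice sets are convex,
  \<open>interior_max\<close> the restriction on choices from segments.\<close>

locale segment_preference =
  fixes D :: "'a::real_normed_vector set" and W :: "'a \<Rightarrow> 'a \<Rightarrow> bool"
  assumes convex_D: "convex D"
    and total: "\<lbrakk>a \<in> D; b \<in> D\<rbrakk> \<Longrightarrow> W a b \<or> W b a"
    and closed_upper: "a \<in> D \<Longrightarrow> closed {x \<in> D. W x a}"
    and closed_lower: "a \<in> D \<Longrightarrow> closed {x \<in> D. W a x}"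
    and convex_lower: "a \<in> D \<Longrightarrow> convex {x \<in> D. W a x}"
    and flat_upper: "\<lbrakk>a \<in> D; b \<in> D; c \<in> D; W a b; W b a; W a c; W b c; x \<in> closed_segment a b\<rbrakk>
          \<Longrightarrow> W x c"
    and interior_max: "\<lbrakk>x \<in> D; y \<in> D; z \<in> D; x \<in> open_segment y z; W x y; W x z\<rbrakk> \<Longrightarrow> W y x"
begin

lemma refl: "a \<in> D \<Longrightarrow> W a a"
  using total by blast

lemma segment_D: "\<lbrakk>a \<in> D; b \<in> D; x \<in> closed_segment a b\<rbrakk> \<Longrightarrow> x \<in> D"
  using convex_D convex_contains_segment by blast

lemma lower_segment:
  "\<lbrakk>a \<in> D; b \<in> D; c \<in> D; W a b; W a c; x \<in> closed_segment b c\<rbrakk> \<Longrightarrow> W a x"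
  using convex_lower[of a] unfolding convex_contains_segment by blast

lemma lower_tri:
  assumes "a \<in> D" "p \<in> D" "q \<in> D" "r \<in> D" "W a p" "W a q" "W a r" "0 \<le> \<alpha>" "0 \<le> \<beta>" "\<alpha> + \<beta> \<le> 1"
  shows "W a (tri p q r \<alpha> \<beta>)"
  using tri_in_convex[OF convex_lower[of a], of p q r \<alpha> \<beta>] assms by auto

lemma flat_segment:
  assumes "a \<in> D" "b \<in> D" "W a b" "W b a" "x \<in> closed_segment a b" "y \<in> closed_segment a b"
  shows "W x y"
proof -
  have "W x a" "W x b" using flat_upper[of a b _ x] assms refl by auto
  then show ?thesis using lower_segment[of x a b y] assms segment_D by blast
qed

text \<open>By totality the two closed weak contour sets at \<open>p\<close> cover the segment,
  which is connected, so they meet on it.\<close>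

lemma ivt:
  assumes "a \<in> D" "b \<in> D" "p \<in> D" "W a p" "W p b"
  obtains y where "y \<in> closed_segment a b" "W y p" "W p y"
proof -
  let ?S = "closed_segment a b"
  let ?A = "{x \<in> D. W x p}" and ?B = "{x \<in> D. W p x}"
  have "connected ?S" by simp
  moreover have "?S \<subseteq> ?A \<union> ?B" using segment_D[OF assms(1,2)] total assms(3) by blast
  moreover have "?A \<inter> ?S \<noteq> {}" "?B \<inter> ?S \<noteq> {}" using assms by (auto intro: ends_in_segment)
  moreover have "closed ?A" "closed ?B" using closed_upper closed_lower assms by auto
  ultimately have "?A \<inter> ?B \<inter> ?S \<noteq> {}" unfolding connected_closed by blast
  then show ?thesis using that by blast
qed

text \<open>If \<open>p\<close> strictly beat \<open>t\<close>, some \<open>y\<close> between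
  \<open>t\<close> and \<open>r\<close> would be indifferent to \<open>p\<close>. Then
  \<open>t\<close> would lie on the segment from \<open>p\<close> to \<open>y\<close>, all of whose
  points are indifferent.\<close>

lemma upper_segment_endpoint:
  assumes "p \<in> D" "r \<in> D" "W r p" "t \<in> closed_segment p r"
  shows "W t p"
proof (rule ccontr)
  assume n: "\<not> W t p"
  have t: "t \<in> D" using segment_D assms by blast
  then have "W p t" using n total assms by blast
  then obtain y where y: "y \<in> closed_segment r t" "W y p" "W p y" using ivt[of r t p] assms t by blast
  have "t \<in> closed_segment p y"
    using closed_segment_nested[of t p r y] y assms by (simp add: closed_segment_commute)
  moreover have "y \<in> D" using segment_D y assms t by blast
  ultimately show False using flat_segment[of p y t p] y n assms by auto
qed

text \<open>One endpoint weakly beats the other, and then \<open>g\<close> weakly beats that other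
  one. Used to obtain \<open>W g h\<close> when \<open>W g r\<close> fails.\<close>

lemma segment_dominates_endpoint:
  assumes "h \<in> D" "r \<in> D" "g \<in> closed_segment h r"
  shows "W g h \<or> W g r"
  using total[of h r] upper_segment_endpoint[of h r g] upper_segment_endpoint[of r h g] assms
  by (auto simp: closed_segment_commute)

lemma interior_max':
  assumes "x \<in> D" "y \<in> D" "z \<in> D" "x = (1 - u) *\<^sub>R y + u *\<^sub>R z" "0 < u" "u < 1" "W x y" "W x z"
  shows "W y x"
proof (cases "y = z")
  case True
  then have "x = y" using assms(4) by (simp add: algebra_simps)
  then show ?thesis using refl assms by simp
next
  case False
  then have "x \<in> open_segment y z" using assms by (auto simp: in_segment)
  then show ?thesis using interior_max assms by blast
qed

section \<open>Strict lower and weak upper contour sets\<close>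

text \<open>Weak contour sets are closed, so their complements are neighbourhoods of the limit. The
  premise \<open>f l \<in> D\<close> is there because the curves used later lie in \<open>D\<close>
  only for small parameters.\<close>

lemma eventually_strict_upper:
  assumes "(f \<longlongrightarrow> p) F" "p \<in> D" "x \<in> D" "\<not> W x p"
  shows "eventually (\<lambda>l. f l \<in> D \<longrightarrow> \<not> W x (f l)) F"
proof -
  have "eventually (\<lambda>l. f l \<in> - {y \<in> D. W x y}) F"
    using topological_tendstoD[OF assms(1), of "- {y \<in> D. W x y}"] closed_lower assms by auto
  then show ?thesis by eventually_elim auto
qed

lemma eventually_strict_lower:
  assumes "(f \<longlongrightarrow> p) F" "p \<in> D" "x \<in> D" "\<not> W p x"
  shows "eventually (\<lambda>l. f l \<in> D \<longrightarrow> \<not> W (f l) x) F"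
proof -
  have "eventually (\<lambda>l. f l \<in> - {y \<in> D. W y x}) F"
    using topological_tendstoD[OF assms(1), of "- {y \<in> D. W y x}"] closed_upper assms by auto
  then show ?thesis by eventually_elim auto
qed

lemma triD:
  "\<lbrakk>p \<in> D; q \<in> D; r \<in> D; 0 \<le> a; 0 \<le> b; a + b \<le> 1\<rbrakk> \<Longrightarrow> tri p q r a b \<in> D"
  using tri_in_convex convex_D by blast

text \<open>If \<open>p\<close> and \<open>s\<close> are indifferent, points between them and close to \<open>p\<close> are maximal in the triangle
  \<open>p\<close>, \<open>q\<close>, \<open>r\<close> but strictly beat \<open>q\<close>.\<close>

lemma strict_lower_segment:
  assumes D: "p \<in> D" "q \<in> D" "r \<in> D" and n: "\<not> W q p" "\<not> W r p" and s: "s \<in> closed_segment q r"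
  shows "\<not> W s p"
proof
  assume sp: "W s p"
  have ps: "W p s" using lower_segment[of p q r s] total D n s by blast
  have sD: "s \<in> D" using segment_D D s by blast
  obtain m where m: "0 \<le> m" "m \<le> 1" "s = tri p q r (1 - m) m" using closed_segment_tri s by metis
  have "m \<noteq> 1" using m(3) sp n by auto
  define t where "t l = tri p q r (l * (1 - m)) (l * m)" for l
  have "(t \<longlongrightarrow> tri p q r (0 * (1 - m)) (0 * m)) (at_right 0)"
    unfolding t_def by (intro tendsto_intros)
  then have lim: "(t \<longlongrightarrow> p) (at_right 0)" by simp
  have "eventually (\<lambda>l. l \<in> {0<..<1} \<and> (t l \<in> D \<longrightarrow> \<not> W q (t l)) \<and> (t l \<in> D \<longrightarrow> \<not> W r (t l))) (at_right 0)"
    using eventually_strict_upper[OF lim] D n by (intro eventually_conj eventually_at_right_real) auto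
  from eventually_happens'[OF trivial_limit_at_right_real this]
  obtain l where l: "0 < l" "l < 1" and
    tn: "t l \<in> D \<longrightarrow> \<not> W q (t l)" "t l \<in> D \<longrightarrow> \<not> W r (t l)"
    by auto
  have tD: "t l \<in> D" unfolding t_def
    using D m l by (intro triD) (auto simp: algebra_simps mult_le_one)
  have tps: "t l \<in> closed_segment p s"
    using tri_in_segment[of l "l * (1 - m)" 0 "1 - m" "l * m" 0 m p q r] l m by (simp add: t_def)
  have t: "W (t l) p" "W (t l) q" "W (t l) r"
    using flat_segment[of p s "t l" p] D sD ps sp tps tD tn total by auto
  \<comment> \<open>\<open>b\<close> is the second coordinate of the projection of
    \<open>t l\<close> from \<open>q\<close> onto the side from \<open>p\<close> to
    \<open>r\<close>. So \<open>t l\<close> lies between \<open>q\<close> and a point that it weakly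
    beats.\<close>
  define b where "b = l * m / (1 - l * (1 - m))"
  have u: "0 < l * (1 - m)" "l * (1 - m) < 1"
    using l m \<open>m \<noteq> 1\<close> mult_less_le_imp_less[of l 1 "1 - m" 1] by auto
  have b: "0 \<le> b" "b \<le> 1" "(1 - l * (1 - m)) * b = l * m"
  proof -
    have "l * m \<le> 1 - l * (1 - m)" using l by (simp add: right_diff_distrib)
    then show "0 \<le> b" "b \<le> 1" "(1 - l * (1 - m)) * b = l * m"
      using u l m unfolding b_def by simp_all
  qed
  have "tri p q r 0 b \<in> closed_segment p r"
    using tri_in_segment[of b 0 0 0 b 0 1 p q r] b by simp
  then have "tri p q r 0 b \<in> D" "W (t l) (tri p q r 0 b)"
    using segment_D D lower_segment tD t by blast+
  moreover have "t l = (1 - (1 - l * (1 - m))) *\<^sub>R q + (1 - l * (1 - m)) *\<^sub>R tri p q r 0 b"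
    unfolding t_def using tri_convex_comb[of "l * (1 - m)" "1 - l * (1 - m)" 1 0 "l * m" 0 b p q r] b(3)
    by simp
  ultimately have "W q (t l)"
    using interior_max'[of "t l" q "tri p q r 0 b" "1 - l * (1 - m)"] u D tD t by simp
  then show False using tn tD by blast
qed

text \<open>The points \<open>w\<close>, \<open>e\<close> and \<open>f\<close> form a small triangle near \<open>p\<close>.  On its side from \<open>w\<close> to \<open>e\<close>
  lies a point \<open>y\<close> that is maximal in the triangle but separates \<open>s\<close> from a point of the side
  from \<open>w\<close> to \<open>f\<close>, so that \<open>s\<close> would have to be indifferent to \<open>y\<close>.\<close>

lemma upper_segment_flat_sides:
  assumes D: "p \<in> D" "q \<in> D" "r \<in> D" and flat: "W p q" "W q p" "W p r" "W r p" and rq: "W r q"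
    and s: "s \<in> closed_segment q r"
  shows "W s p"
proof (rule ccontr)
  assume sp: "\<not> W s p"
  have sD: "s \<in> D" using segment_D D s by blast
  obtain m where m: "0 \<le> m" "m \<le> 1" "s = tri p q r (1 - m) m" using closed_segment_tri s by metis
  \<comment> \<open>Measured in units of \<open>l * (1 - m)\<close> and \<open>l * m\<close>, the
    points are w = (1, 1), e = (4, 0), f = (2, 0), t1 = (0, 4/3), t2 = (0, 8/3), y = (4/3, 8/9) and
    s = (1/l, 1/l). So w lies between e and t1, and y is where the segment from f to t2 meets the
    one from w to e.\<close>
  define e where "e l = tri p q r (4 * l * (1 - m)) 0" for l
  define y where "y l = tri p q r (4/3 * l * (1 - m)) (8/9 * l * m)" for l
  have "(e \<longlongrightarrow> tri p q r (4 * 0 * (1 - m)) 0) (at_right 0)"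
    unfolding e_def by (intro tendsto_intros)
  then have lime: "(e \<longlongrightarrow> p) (at_right 0)" by simp
  have "(y \<longlongrightarrow> tri p q r (4/3 * 0 * (1 - m)) (8/9 * 0 * m)) (at_right 0)"
    unfolding y_def by (intro tendsto_intros)
  then have limy: "(y \<longlongrightarrow> p) (at_right 0)" by simp
  have "eventually (\<lambda>l. l \<in> {0<..<1/4} \<and> (e l \<in> D \<longrightarrow> \<not> W s (e l)) \<and> (y l \<in> D \<longrightarrow> \<not> W s (y l))) (at_right 0)"
    using eventually_strict_upper[OF lime] eventually_strict_upper[OF limy] D sD sp
    by (intro eventually_conj eventually_at_right_real) auto
  from eventually_happens'[OF trivial_limit_at_right_real this]
  obtain l where l: "0 < l" "l < 1/4" and
    n: "e l \<in> D \<longrightarrow> \<not> W s (e l)" "y l \<in> D \<longrightarrow> \<not> W s (y l)"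
    by auto
  have b: "0 \<le> l * (1 - m)" "l * (1 - m) \<le> 1/4" "0 \<le> l * m" "l * m \<le> 1/4"
    using l m mult_mono[of l "1/4" m 1] mult_mono[of l "1/4" "1 - m" 1] by auto
  define w where "w = tri p q r (l * (1 - m)) (l * m)"
  define f where "f = tri p q r (2 * l * (1 - m)) 0"
  define t1 where "t1 = tri p q r 0 (4/3 * l * m)"
  define t2 where "t2 = tri p q r 0 (8/3 * l * m)"
  have e_pq: "e l \<in> closed_segment p q" and f_pq: "f \<in> closed_segment p q"
    using tri_in_segment[of "4 * l * (1 - m)" "4 * l * (1 - m)" 0 1 0 0 0 p q r]
      tri_in_segment[of "2 * l * (1 - m)" "2 * l * (1 - m)" 0 1 0 0 0 p q r] b
    by (auto simp: e_def f_def)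
  have t_pr: "t1 \<in> closed_segment p r" "t2 \<in> closed_segment p r"
    using tri_in_segment[of "4/3 * l * m" 0 0 0 "4/3 * l * m" 0 1 p q r]
      tri_in_segment[of "8/3 * l * m" 0 0 0 "8/3 * l * m" 0 1 p q r] b
    by (auto simp: t1_def t2_def)
  have w_ps: "w \<in> closed_segment p s"
    using tri_in_segment[of l "l * (1 - m)" 0 "1 - m" "l * m" 0 m p q r] l m by (simp add: w_def)
  have w_et: "w \<in> closed_segment (e l) t1"
    using tri_in_segment[of "3/4" "l * (1 - m)" "4 * l * (1 - m)" 0 "l * m" 0 "4/3 * l * m" p q r]
    by (simp add: w_def e_def t1_def)
  have y_ft: "y l \<in> closed_segment f t2"
    using tri_in_segment[of "1/3" "4/3 * l * (1 - m)" "2 * l * (1 - m)" 0 "8/9 * l * m" 0 "8/3 * l * m" p q r]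
    by (simp add: y_def f_def t2_def)
  have y_we: "y l \<in> closed_segment w (e l)"
    unfolding w_def e_def y_def by (rule tri_in_segment[of "1/9"]) (auto simp: field_simps)
  have D': "e l \<in> D" "f \<in> D" "t1 \<in> D" "t2 \<in> D" "w \<in> D"
    using segment_D e_pq f_pq t_pr w_ps D sD by blast+
  then have yD: "y l \<in> D" using segment_D y_we by blast
  have "W (e l) p" "W (e l) s" using flat_segment[of p q "e l" p] D flat e_pq n D' sD total by auto
  then have ew: "W (e l) w" using lower_segment w_ps D' D sD by blast
  \<comment> \<open>Here \<open>rq\<close> enters: both \<open>p\<close> and \<open>r\<close> weakly
    beat \<open>q\<close>, hence so does every point between them, and each such point then weakly
    beats the whole side from \<open>p\<close> to \<open>q\<close>.\<close>
  have tpq: "W t p" "W t q" if "t \<in> closed_segment p r" for t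
    using flat_segment[of p r t p] flat_upper[of p r q t] D flat rq that by auto
  have "W t1 (e l)" "W t2 f"
    using tpq[OF t_pr(1)] tpq[OF t_pr(2)] lower_segment e_pq f_pq D D' by blast+
  then have we: "W w (e l)" and yf: "W (y l) f"
    using upper_segment_endpoint D' w_et y_ft by blast+
  have yw: "W (y l) w" using flat_segment[of w "e l" "y l" w] D' ew we y_we by auto
  \<comment> \<open>\<open>a\<close> and \<open>c\<close> solve y = a s + (1 - a) z with z = (1 - c)
    w + c f: subtracting the two coordinates gives \<open>(1 - a) * c = 2 / 9\<close>, adding them
    gives \<open>a * (1 - l) = l / 9\<close>.\<close>
  define a where "a = l / (9 * (1 - l))"
  define c where "c = 2 / (9 * (1 - a))"
  have a: "0 < a" "a < 1/9" "a * (1 - l) = l / 9" using l by (auto simp: a_def field_simps)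
  have c: "0 \<le> c" "c \<le> 1" "(1 - a) * c = 2 / 9" using a by (auto simp: c_def field_simps)
  define z where "z = tri p q r ((1 - c) * (l * (1 - m)) + c * (2 * l * (1 - m))) ((1 - c) * (l * m))"
  have "z \<in> closed_segment w f"
    using tri_in_segment[OF c(1,2), of _ "l * (1 - m)" "2 * l * (1 - m)" _ "l * m" 0 p q r]
    by (simp add: z_def w_def f_def)
  then have z: "z \<in> D" "W (y l) z" using segment_D lower_segment D' yD yw yf by blast+
  have "y l = (1 - (1 - a)) *\<^sub>R s + (1 - a) *\<^sub>R z"
    unfolding y_def m(3) z_def
  proof (rule tri_convex_comb)
    have "(1 - a) * ((1 - c) * (l * (1 - m)) + c * (2 * l * (1 - m)))
      = l * (1 - m) * (1 - a + (1 - a) * c)" by (simp add: algebra_simps)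
    moreover have "(1 - (1 - a)) * (1 - m) + l * (1 - m) * (1 - a + 2/9) = (1 - m) * (a * (1 - l) + l * (11/9))"
      by (simp add: algebra_simps)
    ultimately show "4/3 * l * (1 - m) = (1 - (1 - a)) * (1 - m)
        + (1 - a) * ((1 - c) * (l * (1 - m)) + c * (2 * l * (1 - m)))"
      unfolding a(3) c(3) by simp
    have "(1 - (1 - a)) * m + (1 - a) * ((1 - c) * (l * m)) = m * (a * (1 - l)) + l * m * (1 - (1 - a) * c)"
      by (simp add: algebra_simps)
    then show "8/9 * l * m = (1 - (1 - a)) * m + (1 - a) * ((1 - c) * (l * m))"
      unfolding a(3) c(3) by simp
  qed
  then have "W s (y l)"
    using interior_max'[of "y l" s z "1 - a"] a yD sD z n total by force
  then show False using n yD by blast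
qed

text \<open>If \<open>s\<close> failed, \<open>q\<close> and \<open>r\<close> could be moved towards
  \<open>s\<close> until they are indifferent to \<open>p\<close>, with \<open>s\<close> still
  between them. Totality decides which of the two moved points plays the role of \<open>r\<close> in
  \<open>upper_segment_flat_sides\<close>.\<close>

lemma upper_segment:
  assumes D: "p \<in> D" "q \<in> D" "r \<in> D" and W: "W q p" "W r p" and s: "s \<in> closed_segment q r"
  shows "W s p"
proof (rule ccontr)
  assume sp: "\<not> W s p"
  have sD: "s \<in> D" using segment_D D s by blast
  then have ps: "W p s" using sp total D by blast
  obtain q' where q': "q' \<in> closed_segment q s" "W q' p" "W p q'" using ivt[of q s p] D sD W ps by blast
  obtain r' where r': "r' \<in> closed_segment r s" "W r' p" "W p r'" using ivt[of r s p] D sD W ps by blast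
  have D': "q' \<in> D" "r' \<in> D" using segment_D D sD q' r' by blast+
  have "s \<in> closed_segment r q'" using closed_segment_nested[of s r q q'] s q' by (simp add: closed_segment_commute)
  then have s': "s \<in> closed_segment q' r'"
    using closed_segment_nested[of s q' r r'] r' by (simp add: closed_segment_commute)
  show False
    using upper_segment_flat_sides[of p q' r' s] upper_segment_flat_sides[of p r' q' s]
      D D' q' r' s' sp total[of q' r'] by (auto simp: closed_segment_commute)
qed

section \<open>Planes through indifferent triples and strict upper contour sets\<close>

text \<open>The weights may be negative, so \<open>y\<close> may lie outside the triangle. If
  \<open>c\<close> strictly beat \<open>y\<close>, so would a point \<open>x l\<close> of the
  triangle near \<open>c\<close>. It is maximal in the triangle and separates \<open>y\<close> from
  another point of it, so \<open>y\<close> would weakly beat \<open>x l\<close>.\<close>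

lemma flat_triangle_minimal:
  assumes D: "a \<in> D" "b \<in> D" "c \<in> D" "y \<in> D"
    and flat: "W a b" "W b a" "W a c" "W c a" "W b c" "W c b"
    and y: "y = \<alpha> *\<^sub>R a + \<beta> *\<^sub>R b + (1 - \<alpha> - \<beta>) *\<^sub>R c"
  shows "W y c"
proof (rule ccontr)
  assume yc: "\<not> W y c"
  have y': "y = tri c a b \<alpha> \<beta>" unfolding y tri_def by (simp add: algebra_simps)
  define x where "x l = tri c a b l l" for l :: real
  have "(x \<longlongrightarrow> tri c a b 0 0) (at_right 0)" unfolding x_def by (intro tendsto_intros)
  then have lim: "(x \<longlongrightarrow> c) (at_right 0)" by simp
  have "eventually (\<lambda>l. l \<in> {0<..<1/4} \<and> (x l \<in> D \<longrightarrow> \<not> W y (x l))) (at_right 0)"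
    using eventually_strict_upper[OF lim] D yc by (intro eventually_conj eventually_at_right_real) auto
  from eventually_happens'[OF trivial_limit_at_right_real this]
  obtain l where l: "0 < l" "l < 1/4" and n: "x l \<in> D \<longrightarrow> \<not> W y (x l)"
    by auto
  have xD: "x l \<in> D" unfolding x_def using D l by (intro triD) auto
  \<comment> \<open>The point \<open>z\<close> below continues the line from \<open>y\<close>
    through \<open>x l\<close> by the factor \<open>d\<close>, which is so small that
    \<open>z\<close> stays in the triangle. Then \<open>v\<close> is the weight of \<open>z\<close>
    in \<open>x l\<close>.\<close>
  define d where "d = l / (1 + \<bar>\<alpha>\<bar> + \<bar>\<beta>\<bar>)"
  have d: "0 < d" "d * (1 + \<bar>\<alpha>\<bar> + \<bar>\<beta>\<bar>) = l" using l by (auto simp: d_def field_simps add_pos_nonneg)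
  have dab: "d + \<bar>d * \<alpha>\<bar> + \<bar>d * \<beta>\<bar> = l" "0 \<le> d * l" "d * l \<le> d"
    using d l by (simp_all add: abs_mult algebra_simps mult_left_le)
  define z where "z = tri c a b (l + d * (l - \<alpha>)) (l + d * (l - \<beta>))"
  have zb: "0 \<le> l + d * (l - \<alpha>)" "0 \<le> l + d * (l - \<beta>)" "l + d * (l - \<alpha>) + (l + d * (l - \<beta>)) \<le> 1"
    using dab l d(1) unfolding right_diff_distrib by linarith+
  have zD: "z \<in> D" unfolding z_def using D zb by (intro triD)
  \<comment> \<open>\<open>x l\<close> lies between \<open>c\<close> and the midpoint
    \<open>h\<close> of \<open>a\<close> and \<open>b\<close>. Applying flatness first to
    \<open>h\<close> and then to \<open>x l\<close> shows that \<open>x l\<close> weakly beats all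
    three vertices.\<close>
  define h where "h = tri c a b (1/2) (1/2)"
  have h: "h \<in> closed_segment a b"
    using tri_in_segment[of "1/2" "1/2" 1 0 "1/2" 0 1 c a b] by (simp add: h_def)
  have hD: "h \<in> D" using segment_D D h by blast
  have hW: "W h a" "W h b" "W h c" "W c h"
    using flat_segment[of a b h a] flat_segment[of a b h b] flat_upper[of a b c h] lower_segment[of c a b h]
      D flat h by auto
  have xh: "x l \<in> closed_segment c h"
    using tri_in_segment[of "2 * l" l 0 "1/2" l 0 "1/2" c a b] l by (simp add: x_def h_def)
  have "W (x l) a" "W (x l) b" "W (x l) c"
    using flat_upper[of c h a] flat_upper[of c h b] flat_upper[of c h c] D hD hW flat xh refl by auto
  then have "W (x l) z" unfolding z_def using lower_tri xD D zb by blast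
  moreover define v where "v = 1 / (1 + d)"
  have v: "0 < v" "v < 1" "v * (1 + d) = 1" using d by (auto simp: v_def)
  have "(1 - v) * A + v * (l + d * (l - A)) = A - (v * (1 + d)) * A + (v * (1 + d)) * l" for A
    by (simp add: algebra_simps)
  then have "x l = (1 - v) *\<^sub>R y + v *\<^sub>R z"
    unfolding x_def y' z_def v(3) by (intro tri_convex_comb) simp_all
  moreover have "W (x l) y" using n xD D total by blast
  ultimately have "W y (x l)" using interior_max'[of "x l" y z v] v D xD zD by blast
  then show False using n xD by blast
qed

text \<open>\<open>h\<close> is the projection of \<open>g\<close> from \<open>r\<close> to the side from \<open>p\<close> to \<open>q\<close>.  The points \<open>g\<close>, \<open>g'\<close> and
  \<open>h\<close> are mutually indifferent, and \<open>p\<close> and \<open>s\<close> lie on the line through \<open>g\<close> and \<open>g'\<close>.\<close>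

lemma projection_minimal:
  fixes l l' m :: real and p q r
  defines "g \<equiv> tri p q r (l * (1 - m)) (l * m)" and "g' \<equiv> tri p q r (l' * (1 - m)) (l' * m)"
    and "s \<equiv> tri p q r (1 - m) m" and "h \<equiv> tri p q r (l * (1 - m) / (1 - l * m)) 0"
  assumes D: "p \<in> D" "q \<in> D" "r \<in> D" and m: "0 < m" "m < 1" and l: "0 < l" "l < l'" "l' < 1"
    and flat: "W p s" "W s p" and W: "\<not> W g r" "\<not> W g' r" "W q g" "W q g'"
  shows "W p h" "W s h"
proof -
  have sD: "s \<in> D" unfolding s_def using D m by (intro triD) auto
  have lm: "l * m < 1" "l' * m < 1" "0 < l * m" "0 < l' * m" "l * m \<le> l' * m"
    using l m mult_strict_mono[of l 1 m 1] mult_strict_mono[of l' 1 m 1] by auto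
  have gps: "g \<in> closed_segment p s" and gps': "g' \<in> closed_segment p s"
    using tri_in_segment[of l "l * (1 - m)" 0 "1 - m" "l * m" 0 m p q r] 
      tri_in_segment[of l' "l' * (1 - m)" 0 "1 - m" "l' * m" 0 m p q r] l m by (simp_all add: g_def g'_def s_def)
  have gD: "g \<in> D" "g' \<in> D" using segment_D D sD gps gps' by blast+
  have flatg: "W x y" if "x \<in> {p, g, g', s}" "y \<in> {p, g, g', s}" for x y
    using flat_segment[of p s x y] D sD flat gps gps' that by auto
  define k where "k = l * (1 - m) / (1 - l * m)"
  define k' where "k' = l' * (1 - m) / (1 - l' * m)"
  have hk: "h = tri p q r k 0" by (simp add: h_def k_def)
  have k: "0 \<le> k" "k \<le> 1" "k * (1 - l * m) = l * (1 - m)" "0 \<le> k'" "k' \<le> 1" "k' * (1 - l' * m) = l' * (1 - m)"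
    using projection_coefficient[of l m] projection_coefficient[of l' m] m l unfolding k_def k'_def by auto
  define h' where "h' = tri p q r k' 0"
  have hpq: "h \<in> closed_segment p q" "h' \<in> closed_segment p q"
    using tri_in_segment[of k k 0 1 0 0 0 p q r] tri_in_segment[of k' k' 0 1 0 0 0 p q r] k by (auto simp: hk h'_def)
  have hD: "h \<in> D" "h' \<in> D" using segment_D D hpq by blast+
  \<comment> \<open>The aim is to write \<open>k\<close> as \<open>k'\<close> times a factor between
    0 and 1, which puts \<open>h\<close> between \<open>p\<close> and \<open>h'\<close>.\<close>
  have "l * c / A = l * B / (l' * A) * (l' * c / B)" if "A > 0" "B > 0" for A B c
    using that l by simp
  from this[of "1 - l * m" "1 - l' * m" "1 - m"]
  have "k = l * (1 - l' * m) / (l' * (1 - l * m)) * k'"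
    using lm l unfolding k_def k'_def by simp
  moreover have "l * (1 - l' * m) \<le> l' * (1 - l * m)" "0 < l' * (1 - l * m)"
    using l lm by (simp_all add: algebra_simps)
  then have "0 \<le> l * (1 - l' * m) / (l' * (1 - l * m))" "l * (1 - l' * m) / (l' * (1 - l * m)) \<le> 1"
    using lm l by simp_all
  ultimately have hph': "h \<in> closed_segment p h'"
    using tri_in_segment[of "l * (1 - l' * m) / (l' * (1 - l * m))" k 0 k' 0 0 0 p q r] by (auto simp: hk h'_def)
  have "g \<in> closed_segment h r" "g' \<in> closed_segment h' r"
    using tri_in_segment[of "l * m" "l * (1 - m)" k 0 "l * m" 0 1 p q r]
      tri_in_segment[of "l' * m" "l' * (1 - m)" k' 0 "l' * m" 0 1 p q r] k lm
    by (auto simp: g_def g'_def hk h'_def mult.commute)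
  \<comment> \<open>Neither \<open>g\<close> nor \<open>g'\<close> weakly beats \<open>r\<close>, so
    each weakly beats the other end of its segment.\<close>
  then have gh: "W g h" "W g' h'" using segment_dominates_endpoint D hD W by blast+
  then have gh': "W g' h" using lower_segment[of g' p h' h] gD D hD hph' flatg by auto
  have hg: "W h g" "W h g'" using upper_segment[of _ p q h] gD D hpq flatg W by auto
  have F: "W (y::'a) h" if "y \<in> D" "y = \<alpha> *\<^sub>R g + (1 - \<alpha>) *\<^sub>R g'" for y \<alpha>
    using flat_triangle_minimal[of g g' h y \<alpha> "1 - \<alpha>"] that gD hD flatg gh gh' hg by auto
  \<comment> \<open>\<open>p\<close> lies before \<open>g\<close> and \<open>s\<close> beyond
    \<open>g'\<close> on their line, so one weight is negative in each combination; \<open>h\<close>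
    has weight zero in both.\<close>
  have "p = (1 - (- l / (l' - l))) *\<^sub>R g + (- l / (l' - l)) *\<^sub>R g'"
    using tri_convex_comb[of 0 "- l / (l' - l)" "l * (1 - m)" "l' * (1 - m)" 0 "l * m" "l' * m" p q r] l
    by (simp add: g_def g'_def field_simps)
  then show "W p h" using F[of p "1 - (- l / (l' - l))"] D by simp
  define u where "u = (1 - l) / (l' - l)"
  have "l + u * (l' - l) = 1" using l by (simp add: u_def)
  moreover have "(1 - u) * (l * c) + u * (l' * c) = (l + u * (l' - l)) * c" for c
    by (simp add: algebra_simps)
  ultimately have "c = (1 - u) * (l * c) + u * (l' * c)" for c by simp
  then have "s = (1 - u) *\<^sub>R g + u *\<^sub>R g'"
    unfolding s_def g_def g'_def by (intro tri_convex_comb)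
  then show "W s h" using F[of s "1 - u"] sD by simp
qed

text \<open>For small \<open>l\<close>, \<open>projection_minimal\<close> applies to
  \<open>g l\<close> and \<open>g (2 * l)\<close> on both sides, so \<open>p\<close> and
  \<open>s\<close> weakly beat the projections \<open>h\<close> and \<open>h'\<close>. One of these
  weakly beats \<open>s\<close> in turn, and \<open>q\<close> lies in the plane of that projection,
  \<open>p\<close> and \<open>s\<close>.\<close>

lemma segment_point_minimal:
  assumes D: "p \<in> D" "q \<in> D" "r \<in> D" and n: "\<not> W p q" "\<not> W p r" and m: "0 < m" "m < 1"
    and s: "s = tri p q r (1 - m) m" and flat: "W p s" "W s p"
  shows "W q s"
proof -
  have sD: "s \<in> D" unfolding s using D m by (intro triD) auto
  have qp: "W q p" "W r p" using n D total by blast+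
  define g where "g l = tri p q r (l * (1 - m)) (l * m)" for l
  have gD: "g l \<in> D" if "0 < l" "l < 1" for l unfolding g_def
    using D m that by (intro triD) (auto simp: algebra_simps mult_le_one)
  have "(g \<longlongrightarrow> tri p q r (0 * (1 - m)) (0 * m)) (at_right 0)"
    unfolding g_def by (intro tendsto_intros)
  then have lim: "(g \<longlongrightarrow> p) (at_right 0)" by simp
  have "((\<lambda>l. g (2 * l)) \<longlongrightarrow> tri p q r ((2 * 0) * (1 - m)) ((2 * 0) * m)) (at_right 0)"
    unfolding g_def by (intro tendsto_intros)
  then have lim2: "((\<lambda>l. g (2 * l)) \<longlongrightarrow> p) (at_right 0)" by simp
  have "eventually (\<lambda>l. l \<in> {0<..<1/2} \<and> (g l \<in> D \<longrightarrow> \<not> W (g l) q) \<and> (g l \<in> D \<longrightarrow> \<not> W (g l) r)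
      \<and> (g (2 * l) \<in> D \<longrightarrow> \<not> W (g (2 * l)) q) \<and> (g (2 * l) \<in> D \<longrightarrow> \<not> W (g (2 * l)) r)) (at_right 0)"
    using eventually_strict_lower[OF lim] eventually_strict_lower[OF lim2] D n
    by (intro eventually_conj eventually_at_right_real) auto
  from eventually_happens'[OF trivial_limit_at_right_real this]
  obtain l where l: "0 < l" "l < 1/2" and
    "g l \<in> D \<longrightarrow> \<not> W (g l) q \<and> \<not> W (g l) r" "g (2 * l) \<in> D \<longrightarrow> \<not> W (g (2 * l)) q \<and> \<not> W (g (2 * l)) r"
    by auto
  then have gn: "\<not> W (g l) q" "\<not> W (g l) r" "\<not> W (g (2 * l)) q" "\<not> W (g (2 * l)) r"
    using gD by auto
  have gW: "W q (g l)" "W r (g l)" "W q (g (2 * l))" "W r (g (2 * l))"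
    using total gn gD[of l] gD[of "2 * l"] l D by auto
  have u: "l * m < 1" "l * (1 - m) < 1" "0 < l * m" "0 < l * (1 - m)" "l * m + l * (1 - m) = l"
    using l m mult_strict_mono[of l 1 m 1] mult_strict_mono[of l 1 "1 - m" 1] by (auto simp: algebra_simps)
  define k where "k = l * (1 - m) / (1 - l * m)"
  define k' where "k' = l * m / (1 - l * (1 - m))"
  define h where "h = tri p q r k 0"
  define h' where "h' = tri p q r 0 k'"
  have k: "0 < k" "k \<le> 1" "0 < k'" "k' \<le> 1" "k * (1 - l * m) = l * (1 - m)" "k' * (1 - l * (1 - m)) = l * m"
    using projection_coefficient[of l m] projection_coefficient[of l "1 - m"] m l unfolding k_def k'_def by auto
  have h: "W p h" "W s h"
    using projection_minimal[of p q r m l "2 * l"] D m l gn gW flat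
    by (simp_all add: h_def k_def s g_def)
  have h': "W p h'" "W s h'"
    using projection_minimal[of p r q "1 - m" l "2 * l"] D m l gn gW flat
    by (simp_all add: h'_def k'_def s g_def tri_swap[of p r q])
  have hpq: "h \<in> closed_segment p q" "h' \<in> closed_segment p r"
    using tri_in_segment[of k k 0 1 0 0 0 p q r] tri_in_segment[of k' 0 0 0 k' 0 1 p q r] k by (auto simp: h_def h'_def)
  have hD: "h \<in> D" "h' \<in> D" using segment_D D hpq by blast+
  have hp: "W h p" "W h' p" using upper_segment_endpoint D qp hpq by blast+
  \<comment> \<open>\<open>c\<close> is where the segments from \<open>p\<close> to \<open>s\<close>
    and from \<open>h\<close> to \<open>h'\<close> cross. It is indifferent to \<open>s\<close>, so
    \<open>s\<close> cannot strictly beat both \<open>h\<close> and \<open>h'\<close>.\<close>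
  define c where "c = tri p q r (l / (2 - l) * (1 - m)) (l / (2 - l) * m)"
  have "c \<in> closed_segment p s"
    using tri_in_segment[of "l / (2 - l)" "l / (2 - l) * (1 - m)" 0 "1 - m" "l / (2 - l) * m" 0 m p q r] l m
    by (simp add: c_def s)
  then have "W c s" using flat_segment[of p s c s] D sD flat by auto
  have cc: "c \<in> closed_segment h h'" unfolding c_def h_def h'_def
  proof (rule tri_in_segment)
    let ?u = "(1 - l * (1 - m)) / (2 - l)"
    have "1 - l * (1 - m) \<le> 2 - l" using u by linarith
    then show "0 \<le> ?u" "?u \<le> 1" using u l by simp_all
    have "1 - ?u = (1 - l * m) / (2 - l)" using l by (simp add: field_simps)
    then show "l / (2 - l) * (1 - m) = (1 - ?u) * k + ?u * 0" using k(5) by (simp add: mult.commute)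
    show "l / (2 - l) * m = (1 - ?u) * 0 + ?u * k'" using k(6) by (simp add: mult.commute)
  qed
  have "W h s \<or> W h' s"
    using strict_lower_segment[of s h h' c] sD hD cc \<open>W c s\<close> by blast
  then show "W q s"
  proof
    assume "W h s"
    moreover have "q = (1 - 1 / k) *\<^sub>R p + (1 / k) *\<^sub>R h + (1 - (1 - 1 / k) - 1 / k) *\<^sub>R s"
      using tri_convex_comb[of 1 "1 / k" 0 k 0 0 0 p q r] k by (simp add: h_def)
    ultimately show ?thesis using flat_triangle_minimal[of p h s q] D hD sD flat h hp by blast
  next
    assume "W h' s"
    \<comment> \<open>From s = (1 - m) q + m r follows q = (1 + c) s - c r, now with a number
      \<open>c\<close>. Substitute r = (1 - v) p + v h'.\<close>
    moreover define c where "c = m / (1 - m)"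
    define v where "v = 1 / k'"
    have cv: "c * (1 - m) = m" "v * k' = 1" using m k by (auto simp: c_def v_def)
    have "tri p q r 1 0 = (- c * (1 - v)) *\<^sub>R tri p q r 0 0 + (- c * v) *\<^sub>R tri p q r 0 k'
        + (1 - (- c * (1 - v)) - (- c * v)) *\<^sub>R tri p q r (1 - m) m"
    proof (rule tri_affine)
      have "1 = (1 + c) * (1 - m)" using cv(1) by (simp add: algebra_simps)
      then show "1 = - c * (1 - v) * 0 + - c * v * 0 + (1 - - c * (1 - v) - - c * v) * (1 - m)"
        by (simp add: algebra_simps)
      have "(1 + c) * m = c * (v * k')" using cv by (simp add: algebra_simps)
      then show "0 = - c * (1 - v) * 0 + - c * v * k' + (1 - - c * (1 - v) - - c * v) * m"
        by (simp add: algebra_simps)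
    qed
    then have "q = (- c * (1 - v)) *\<^sub>R p + (- c * v) *\<^sub>R h' + (1 - (- c * (1 - v)) - (- c * v)) *\<^sub>R s"
      unfolding tri_vertices h'_def[symmetric] s[symmetric] .
    ultimately show ?thesis using flat_triangle_minimal[of p h' s q] D hD sD flat h' hp by blast
  qed
qed

text \<open>As \<open>l\<close> tends to 1, the projection \<open>h l\<close> tends to \<open>q\<close>, but \<open>p\<close> weakly beats it.\<close>

lemma strict_upper_segment:
  assumes D: "p \<in> D" "q \<in> D" "r \<in> D" and n: "\<not> W p q" "\<not> W p r" and s: "s \<in> closed_segment q r"
  shows "\<not> W p s"
proof
  assume ps: "W p s"
  have sD: "s \<in> D" using segment_D D s by blast
  have qp: "W q p" "W r p" using n D total by blast+
  then have sp: "W s p" using upper_segment D s by blast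
  obtain m where "0 \<le> m" "m \<le> 1" and sm: "s = tri p q r (1 - m) m" using closed_segment_tri s by metis
  moreover have "m \<noteq> 0" "m \<noteq> 1" using sm ps n by auto
  ultimately have m: "0 < m" "m < 1" by auto
  have "W q s" using segment_point_minimal D n m sm ps sp by blast
  have "W r s" using segment_point_minimal[of p r q "1 - m" s] D n m sm ps sp by (simp add: tri_swap[of p r q])
  define g where "g l = tri p q r (l * (1 - m)) (l * m)" for l
  have gps: "g l \<in> closed_segment p s" if "0 < l" "l < 1" for l
    using tri_in_segment[of l "l * (1 - m)" 0 "1 - m" "l * m" 0 m p q r] that m by (simp add: g_def sm)
  have gD: "g l \<in> D" if "0 < l" "l < 1" for l using gps[OF that] segment_D D sD by blast
  have flatg: "W (g l) s" "W s (g l)" if "0 < l" "l < 1" for l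
    using flat_segment[of p s] gps[OF that] D sD ps sp by auto
  have gW: "W q (g l)" "W r (g l)" if "0 < l" "l < 1" for l
  proof -
    have "W x (g l)" if x: "x \<in> D" "W x p" "W x s" for x
      using lower_segment[of x p s "g l"] x gps \<open>0 < l\<close> \<open>l < 1\<close> D sD by blast
    then show "W q (g l)" "W r (g l)" using D qp \<open>W q s\<close> \<open>W r s\<close> by blast+
  qed
  \<comment> \<open>Otherwise \<open>strict_lower_segment\<close> at \<open>r\<close> makes
    \<open>g l\<close>, \<open>s\<close> and \<open>r\<close> mutually indifferent. As
    \<open>p\<close> is on the line through \<open>g l\<close> and \<open>s\<close>, it would weakly
    beat \<open>r\<close>.\<close>
  have gr: "\<not> W (g l) r" if l: "0 < l" "l < 1" for l
  proof
    assume gr: "W (g l) r"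
    then have "W s r" using strict_lower_segment[of r p s "g l"] D sD n gps[OF l] by blast
    moreover have "p = (1 / (1 - l)) *\<^sub>R g l + (- l / (1 - l)) *\<^sub>R s + (1 - 1 / (1 - l) - (- l / (1 - l))) *\<^sub>R r"
      using tri_affine[of 0 "1 / (1 - l)" "l * (1 - m)" "- l / (1 - l)" "1 - m" 0 0 "l * m" m 1 p q r] l
      by (simp add: g_def sm field_simps)
    ultimately have "W p r"
      using flat_triangle_minimal[of "g l" s r p] D sD gD[OF l] flatg[OF l] gr gW[OF l] \<open>W r s\<close> by blast
    then show False using n by blast
  qed
  define h where "h l = tri p q r (l * (1 - m) / (1 - l * m)) 0" for l
  have "(h \<longlongrightarrow> tri p q r (1 * (1 - m) / (1 - 1 * m)) 0) (at_left 1)"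
    unfolding h_def using m by (intro tendsto_intros) auto
  then have lim: "(h \<longlongrightarrow> q) (at_left 1)" using m by simp
  have "eventually (\<lambda>l. l \<in> {0<..<1} \<and> (h l \<in> D \<longrightarrow> \<not> W p (h l))) (at_left 1)"
    using eventually_strict_upper[OF lim] D n by (intro eventually_conj eventually_at_left_real) auto
  from eventually_happens'[OF trivial_limit_at_left_real this]
  obtain l where l: "0 < l" "l < 1" and hn: "h l \<in> D \<longrightarrow> \<not> W p (h l)"
    by auto
  have "l * m < 1" using l m mult_strict_mono[of l 1 m 1] by auto
  then have "h l \<in> D" unfolding h_def using D l m by (intro triD) (auto simp: field_simps)
  \<comment> \<open>The second parameter \<open>(1 + l) / 2\<close> is just some number between
    \<open>l\<close> and 1.\<close>
  moreover have "W p (h l)"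
    using projection_minimal(1)[of p q r m l "(1 + l) / 2"] D m l gr[of l] gr[of "(1 + l) / 2"]
      gW[of l] gW[of "(1 + l) / 2"] ps sp sm by (simp add: h_def g_def)
  ultimately show False using hn by blast
qed

end

section \<open>Feasible sets and convergence in Hausdorff distance\<close>

lemma convex_prob_simplex: "convex prob_simplex"
  unfolding convex_def prob_simplex_def
  by (auto simp: sum.distrib simp flip: sum_distrib_left)

lemma closed_prob_simplex: "closed prob_simplex"
  unfolding prob_simplex_def Collect_conj_eq
  by (intro closed_Int closed_Collect_all closed_Collect_le closed_Collect_eq continuous_intros)

lemma feasible_convex_hull:
  assumes "finite F" "F \<noteq> {}" "F \<subseteq> prob_simplex"
  shows "convex hull F \<in> feasible"
  unfolding feasible_def
  using assms convex_prob_simplex finite_imp_compact_convex_hull by (auto intro: hull_minimal[THEN subsetD])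

lemma feasible_segment:
  "\<lbrakk>a \<in> prob_simplex; b \<in> prob_simplex\<rbrakk> \<Longrightarrow> closed_segment a b \<in> feasible"
  using feasible_convex_hull[of "{a, b}"] by (simp add: segment_convex_hull)

text \<open>Nonnegativity also rests on the bound \<open>e\<close>: a supremum of reals dominates
  its members only if they are bounded above.\<close>

lemma hausdorff_dist_bounds:
  assumes "X \<noteq> {}" "Y \<noteq> {}" "\<And>x. x \<in> X \<Longrightarrow> \<exists>y\<in>Y. dist x y \<le> e" "\<And>y. y \<in> Y \<Longrightarrow> \<exists>x\<in>X. dist x y \<le> e"
  shows "0 \<le> hausdorff_dist X Y" "hausdorff_dist X Y \<le> e"
proof -
  have X: "infdist x Y \<le> e" if "x \<in> X" for x
    using assms(3)[OF that] infdist_le2 by blast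
  have Y: "infdist y X \<le> e" if "y \<in> Y" for y
    using assms(4)[OF that] infdist_le2 by (metis dist_commute)
  show "hausdorff_dist X Y \<le> e"
    unfolding hausdorff_dist_def using assms(1,2) X Y by (auto intro!: cSUP_least)
  obtain x where x: "x \<in> X" using assms(1) by blast
  have "bdd_above ((\<lambda>x. infdist x Y) ` X)" using X by (intro bdd_aboveI2)
  then have "infdist x Y \<le> (SUP x\<in>X. infdist x Y)" using x by (intro cSUP_upper)
  then show "0 \<le> hausdorff_dist X Y" unfolding hausdorff_dist_def
    using infdist_nonneg[of x Y] by linarith
qed

lemma upper_hemicontinuousD:
  assumes S: "upper_hemicontinuous S" and F: "\<And>i. X i \<in> feasible" "Y \<in> feasible"
    and close: "\<And>i x. x \<in> X i \<Longrightarrow> \<exists>y\<in>Y. dist x y \<le> e i" "\<And>i y. y \<in> Y \<Longrightarrow> \<exists>x\<in>X i. dist x y \<le> e i"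
    and e: "e \<longlonglongrightarrow> 0" and p: "\<And>i. p i \<in> S (X i)" "q \<in> prob_simplex" "p \<longlonglongrightarrow> q"
  shows "q \<in> S Y"
proof -
  have ne: "X i \<noteq> {}" "Y \<noteq> {}" for i using F unfolding feasible_def by auto
  have "(\<lambda>i. hausdorff_dist (X i) Y) \<longlonglongrightarrow> 0"
    using hausdorff_dist_bounds[OF ne close] by (intro tendsto_sandwich[OF _ _ tendsto_const e]) auto
  then show ?thesis using S F p unfolding upper_hemicontinuous_def by blast
qed

text \<open>Keep the parameter on the segment and move only the endpoint.\<close>

lemma closed_segment_close:
  fixes a b c :: "'a::real_normed_vector"
  assumes "x \<in> closed_segment a b"
  shows "\<exists>y\<in>closed_segment a c. dist x y \<le> dist b c"
proof -
  obtain u where u: "0 \<le> u" "u \<le> 1" "x = (1 - u) *\<^sub>R a + u *\<^sub>R b" using assms by (auto simp: in_segment)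
  have "x - ((1 - u) *\<^sub>R a + u *\<^sub>R c) = u *\<^sub>R (b - c)" unfolding u by (simp add: algebra_simps)
  then have "dist x ((1 - u) *\<^sub>R a + u *\<^sub>R c) \<le> dist b c"
    using u by (simp add: dist_norm mult_left_le_one_le)
  moreover have "(1 - u) *\<^sub>R a + u *\<^sub>R c \<in> closed_segment a c" using u by (auto simp: in_segment)
  ultimately show ?thesis by blast
qed

text \<open>Source of both closedness axioms: \<open>p\<close> is taken to be the moving endpoint
  \<open>x\<close> for upper contour sets and the constant \<open>a\<close> for lower ones.\<close>

lemma tendsto_in_choice_segment:
  assumes S: "upper_hemicontinuous S" and a: "a \<in> prob_simplex"
    and x: "\<And>i. x i \<in> prob_simplex" "x \<longlonglongrightarrow> l"
    and p: "\<And>i. p i \<in> S (closed_segment a (x i))" "p \<longlonglongrightarrow> q" and q: "q \<in> prob_simplex"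
  shows "q \<in> S (closed_segment a l)"
proof (rule upper_hemicontinuousD[OF S])
  have l: "l \<in> prob_simplex"
    using closed_prob_simplex x unfolding closed_sequential_limits by blast
  show "closed_segment a (x i) \<in> feasible" "closed_segment a l \<in> feasible" for i
    using a x l feasible_segment by auto
  show "(\<lambda>i. dist (x i) l) \<longlonglongrightarrow> 0" using x(2) by (rule tendsto_dist_iff[THEN iffD1])
  show "\<exists>z\<in>closed_segment a l. dist y z \<le> dist (x i) l" if "y \<in> closed_segment a (x i)" for y i
    using that by (rule closed_segment_close)
  show "\<exists>z\<in>closed_segment a (x i). dist z y \<le> dist (x i) l" if "y \<in> closed_segment a l" for y i
    using closed_segment_close[OF that, of "x i"] by (metis dist_commute)
qed (use p q in auto)

section \<open>Revealed preference of a consistent choice function\<close>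

locale consistent_choice =
  fixes S :: "(real ^ 'u::finite) set \<Rightarrow> (real ^ 'u) set"
  assumes choice: "choice_function S" and consistent: "consistent S"
begin

definition W :: "real ^ 'u \<Rightarrow> real ^ 'u \<Rightarrow> bool" where
  "W a b \<longleftrightarrow> a \<in> S (closed_segment a b)"

lemma uhc: "upper_hemicontinuous S"
  using choice unfolding choice_function_def by blast

lemma segment_choice:
  "\<lbrakk>a \<in> prob_simplex; b \<in> prob_simplex\<rbrakk> \<Longrightarrow> S (closed_segment a b) \<in> {{a}, {b}, closed_segment a b}"
  using choice unfolding choice_function_def segment_convex_hull by blast

lemma contract:
  assumes "X \<in> feasible" "Y \<in> feasible" "Y \<subseteq> X" "a \<in> S X" "a \<in> Y"
  shows "a \<in> S Y"
proof -
  have "X \<inter> Y = Y" using assms by blast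
  then show ?thesis using assms consistent unfolding consistent_def contraction_def
    by (metis IntI emptyE subset_iff)
qed

lemma contract_segment:
  assumes "X \<in> feasible" "a \<in> S X" "b \<in> X"
  shows "W a b"
proof -
  have "a \<in> X" using assms choice unfolding choice_function_def by blast
  then have "a \<in> prob_simplex" "b \<in> prob_simplex" "closed_segment a b \<subseteq> X"
    using assms unfolding feasible_def by (auto simp: closed_segment_subset)
  then show ?thesis
    unfolding W_def using contract[of X "closed_segment a b" a] feasible_segment[of a b] assms by simp
qed

text \<open>Points are added one at a time: \<open>a\<close> is chosen from the hull so far and from
  the segment to the new point, so expansion applies to these two sets.\<close>

lemma expand_finite:
  assumes "finite F" "F \<subseteq> prob_simplex" "a \<in> prob_simplex" "\<And>b. b \<in> F \<Longrightarrow> W a b"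
  shows "a \<in> S (convex hull (insert a F))"
  using assms
proof (induction F)
  case empty
  have "S (convex hull {a}) \<in> feasible \<and> S (convex hull {a}) \<subseteq> convex hull {a}"
    using choice feasible_convex_hull[of "{a}"] empty unfolding choice_function_def by simp
  then show ?case unfolding feasible_def by auto
next
  case (insert b F)
  let ?X = "convex hull (insert a F)" and ?Y = "convex hull {a, b}"
  have "a \<in> S ?X" "a \<in> S ?Y" using insert by (auto simp: W_def segment_convex_hull)
  moreover have "?X \<in> feasible" "?Y \<in> feasible" using insert by (auto intro!: feasible_convex_hull)
  ultimately have "a \<in> S (convex hull (?X \<union> ?Y))"
    using consistent unfolding consistent_def expansion_def by blast
  moreover have "convex hull (?X \<union> ?Y) = convex hull (insert a F \<union> {a, b})"
    by (metis hull_Un_left hull_Un_right)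
  moreover have "insert a F \<union> {a, b} = insert a (insert b F)" by blast
  ultimately show ?case by simp
qed

lemma finite_hull_contract:
  assumes "finite F" "F \<subseteq> prob_simplex" "a \<in> S (convex hull F)" "b \<in> convex hull F"
  shows "W a b"
proof -
  have "F \<noteq> {}" using assms by auto
  then show ?thesis using contract_segment feasible_convex_hull assms by blast
qed

text \<open>Closedness comes from upper hemicontinuity. For \<open>convex_lower\<close> and
  \<open>flat_upper\<close>, expansion yields choices from a triangle, and contraction passes from
  it to a segment.\<close>

sublocale segment_preference prob_simplex W
proof
  show "convex prob_simplex" by (rule convex_prob_simplex)
next
  fix a b :: "real ^ 'u"
  assume "a \<in> prob_simplex" "b \<in> prob_simplex"
  then show "W a b \<or> W b a"
    using segment_choice[of a b] unfolding W_def by (auto simp: closed_segment_commute)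
next
  fix a :: "real ^ 'u"
  assume a: "a \<in> prob_simplex"
  show "closed {x \<in> prob_simplex. W x a}" unfolding closed_sequential_limits
  proof (intro allI impI)
    fix x l assume x: "(\<forall>n. x n \<in> {x \<in> prob_simplex. W x a}) \<and> x \<longlonglongrightarrow> l"
    then have l: "l \<in> prob_simplex"
      using closed_prob_simplex unfolding closed_sequential_limits by blast
    have "l \<in> S (closed_segment a l)"
      using x l by (intro tendsto_in_choice_segment[OF uhc a, of x l x]) (auto simp: W_def closed_segment_commute)
    then show "l \<in> {x \<in> prob_simplex. W x a}" using l by (simp add: W_def closed_segment_commute)
  qed
  show "closed {x \<in> prob_simplex. W a x}" unfolding closed_sequential_limits
  proof (intro allI impI)
    fix x l assume x: "(\<forall>n. x n \<in> {x \<in> prob_simplex. W a x}) \<and> x \<longlonglongrightarrow> l"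
    then have l: "l \<in> prob_simplex"
      using closed_prob_simplex unfolding closed_sequential_limits by blast
    have "a \<in> S (closed_segment a l)"
      using x a by (intro tendsto_in_choice_segment[OF uhc a, of x l "\<lambda>_. a"]) (auto simp: W_def)
    then show "l \<in> {x \<in> prob_simplex. W a x}" using l by (simp add: W_def)
  qed
  show "convex {x \<in> prob_simplex. W a x}" unfolding convex_contains_segment
  proof (intro ballI subsetI)
    fix b c x
    assume b: "b \<in> {x \<in> prob_simplex. W a x}" and c: "c \<in> {x \<in> prob_simplex. W a x}"
      and x: "x \<in> closed_segment b c"
    have "a \<in> S (convex hull {a, b, c})" using expand_finite[of "{b, c}" a] a b c by auto
    moreover have "x \<in> convex hull {a, b, c}"
      using x hull_mono[of "{b, c}" "{a, b, c}"] by (auto simp: segment_convex_hull)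
    ultimately have "W a x" using finite_hull_contract[of "{a, b, c}"] a b c by auto
    moreover have "x \<in> prob_simplex"
      using x b c convex_prob_simplex convex_contains_segment by blast
    ultimately show "x \<in> {x \<in> prob_simplex. W a x}" by blast
  qed
next
  fix a b c x :: "real ^ 'u"
  assume D: "a \<in> prob_simplex" "b \<in> prob_simplex" "c \<in> prob_simplex"
    and W: "W a b" "W b a" "W a c" "W b c" and x: "x \<in> closed_segment a b"
  let ?X = "convex hull {a, b, c}"
  have "a \<in> S ?X" using expand_finite[of "{b, c}" a] D W by auto
  moreover have "b \<in> S ?X" using expand_finite[of "{a, c}" b] D W by (auto simp: insert_commute)
  moreover have "convex (S ?X)"
    using choice feasible_convex_hull[of "{a, b, c}"] D unfolding choice_function_def feasible_def by auto
  ultimately have "x \<in> S ?X" using x convex_contains_segment by blast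
  then show "W x c" using finite_hull_contract[of "{a, b, c}"] D by (auto intro: hull_inc)
next
  fix x y z :: "real ^ 'u"
  assume D: "x \<in> prob_simplex" "y \<in> prob_simplex" "z \<in> prob_simplex"
    and x: "x \<in> open_segment y z" and W: "W x y" "W x z"
  have xyz: "x \<in> closed_segment y z" "x \<noteq> y" "x \<noteq> z" using x by (auto simp: open_segment_def)
  have "convex hull {x, y, z} = closed_segment y z"
    using xyz(1) unfolding segment_convex_hull by (rule hull_redundant)
  moreover have "x \<in> S (convex hull {x, y, z})" using expand_finite[of "{y, z}" x] D W by auto
  \<comment> \<open>The chosen point \<open>x\<close> is neither endpoint, which leaves the whole
    segment as the only admissible choice set.\<close>
  ultimately have "S (closed_segment y z) = closed_segment y z"
    using segment_choice[of y z] D xyz by auto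
  then have "y \<in> S (convex hull {y, z})" by (metis ends_in_segment(1) segment_convex_hull)
  then show "W y x" using finite_hull_contract[of "{y, z}" y x] D xyz(1)
    by (auto simp: segment_convex_hull)
qed

lemma choice_eq_maximal:
  assumes X: "X \<in> feasible"
  shows "S X = {x \<in> X. \<forall>y\<in>X. W x y}"
proof (intro equalityI subsetI)
  fix x assume "x \<in> S X"
  then show "x \<in> {x \<in> X. \<forall>y\<in>X. W x y}"
    using contract_segment X choice unfolding choice_function_def by blast
next
  fix x assume x: "x \<in> {x \<in> X. \<forall>y\<in>X. W x y}"
  have XD: "X \<subseteq> prob_simplex" "compact X" "convex X" using X unfolding feasible_def by auto
  \<comment> \<open>Finite nets of mesh \<open>1 / real (Suc n)\<close> exist by compactness. Their
    hulls together with \<open>x\<close> are polytopes inside \<open>X\<close> that converge to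
    \<open>X\<close>, and \<open>x\<close> is chosen from each of them.\<close>
  have "\<exists>F. finite F \<and> F \<subseteq> X \<and> X \<subseteq> (\<Union>y\<in>F. ball y (1 / real (Suc n)))" for n
  proof -
    have "X \<subseteq> (\<Union>y\<in>X. ball y (1 / real (Suc n)))" by auto
    from compactE_image[OF XD(2) _ this] show ?thesis by (metis open_ball)
  qed
  then obtain F where F: "\<And>n. finite (F n)" "\<And>n. F n \<subseteq> X" "\<And>n. X \<subseteq> (\<Union>y\<in>F n. ball y (1 / real (Suc n)))"
    by metis
  let ?P = "\<lambda>n. convex hull (insert x (F n))"
  have PX: "?P n \<subseteq> X" for n using F(2)[of n] x XD(3) by (intro hull_minimal) auto
  show "x \<in> S X"
  proof (rule upper_hemicontinuousD[OF uhc])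
    show "?P n \<in> feasible" for n
      using F[of n] x XD by (intro feasible_convex_hull) auto
    show "X \<in> feasible" by (rule X)
    show "(\<lambda>n. 1 / real (Suc n)) \<longlonglongrightarrow> 0" using LIMSEQ_inverse_real_of_nat unfolding inverse_eq_divide .
    show "\<exists>z\<in>X. dist y z \<le> 1 / real (Suc n)" if "y \<in> ?P n" for y n
      using that PX[of n] by (intro bexI[of _ y]) auto
    show "\<exists>z\<in>?P n. dist z y \<le> 1 / real (Suc n)" if "y \<in> X" for y n
    proof -
      obtain z where "z \<in> F n" "dist z y < 1 / real (Suc n)" using subsetD[OF F(3) \<open>y \<in> X\<close>, of n] by (auto simp del: of_nat_Suc)
      then show ?thesis by (intro bexI[of _ z]) (auto intro: hull_inc)
    qed
    show "x \<in> S (?P n)" for n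
      using expand_finite[of "F n" x] F[of n] x XD by blast
    show "x \<in> prob_simplex" using x XD by blast
  qed simp
qed

section \<open>The strict preference and its representation of the choice function\<close>

text \<open>The strict part of \<open>W\<close>, which by totality is the negated converse.
  Restricting it to the simplex meets the domain condition of
  \<open>preference_relation\<close>.\<close>

definition R :: "real ^ 'u \<Rightarrow> real ^ 'u \<Rightarrow> bool" where
  "R p q \<longleftrightarrow> p \<in> prob_simplex \<and> q \<in> prob_simplex \<and> \<not> W q p"

lemma weak_pref_R:
  "\<lbrakk>p \<in> prob_simplex; q \<in> prob_simplex\<rbrakk> \<Longrightarrow> weak_pref R p q \<longleftrightarrow> W p q"
  using total unfolding weak_pref_def indiff_def R_def by blast

lemma preference_relation_R: "preference_relation R"
  unfolding preference_relation_def
proof (intro conjI asympI)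
  show "\<forall>p q. R p q \<longrightarrow> p \<in> prob_simplex \<and> q \<in> prob_simplex" by (simp add: R_def)
  show "\<not> R q p" if "R p q" for p q using that total[of p q] unfolding R_def by blast
qed

lemma continuous_R: "continuous_pref R"
proof -
  have "openin (top_of_set prob_simplex) {x \<in> prob_simplex. x \<notin> C}" if "closed C" for C :: "(real ^ 'u) set"
    using openin_open_Int[of "- C" prob_simplex] that by (simp add: Int_def open_Compl)
  from this[OF closed_lower] this[OF closed_upper]
  show ?thesis unfolding continuous_pref_def upper_set_def lower_set_def R_def
    by (auto cong: conj_cong)
qed

lemma convex_R: "convex_pref R"
  unfolding convex_pref_def
proof (intro ballI conjI)
  fix p :: "real ^ 'u" assume p: "p \<in> prob_simplex"
  \<comment> \<open>Totality rewrites the contour sets in terms of \<open>W\<close>; convexity is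
    then an axiom for one of them and a segment lemma for each of the others.\<close>
  have sets: "upper_set R p = {q \<in> prob_simplex. \<not> W p q}" "lower_set R p = {q \<in> prob_simplex. \<not> W q p}"
    "upper_set R p \<union> indiff_set R p = {q \<in> prob_simplex. W q p}"
    "lower_set R p \<union> indiff_set R p = {q \<in> prob_simplex. W p q}"
    using p total unfolding upper_set_def lower_set_def indiff_set_def indiff_def R_def by blast+
  have convexI: "convex {q \<in> prob_simplex. P q}"
    if "\<And>a b s. \<lbrakk>a \<in> prob_simplex; b \<in> prob_simplex; P a; P b; s \<in> closed_segment a b\<rbrakk> \<Longrightarrow> P s"
    for P :: "real ^ 'u \<Rightarrow> bool"
    unfolding convex_contains_segment
  proof (intro ballI subsetI CollectI conjI)
    fix a b s assume "a \<in> {q \<in> prob_simplex. P q}" "b \<in> {q \<in> prob_simplex. P q}" "s \<in> closed_segment a b"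
    then show "s \<in> prob_simplex" "P s" using that[of a b s] segment_D[of a b s] by auto
  qed
  have "convex {q \<in> prob_simplex. \<not> W p q}"
    by (rule convexI) (rule strict_upper_segment[OF p])
  moreover have "convex {q \<in> prob_simplex. \<not> W q p}"
    by (rule convexI) (rule strict_lower_segment[OF p])
  moreover have "convex {q \<in> prob_simplex. W q p}"
    by (rule convexI) (rule upper_segment[OF p])
  ultimately show "convex (upper_set R p)" "convex (lower_set R p)"
    "convex (upper_set R p \<union> indiff_set R p)" "convex (lower_set R p \<union> indiff_set R p)"
    using convex_lower[OF p] unfolding sets(1,2) unfolding sets(3,4)[unfolded sets(1,2)] by blast+
qed

lemma choice_eq_max_set: "X \<in> feasible \<Longrightarrow> S X = max_set R X"
  using choice_eq_maximal[of X] weak_pref_R unfolding max_set_def feasible_def by blast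

end

section \<open>Consistency of maximisation\<close>

text \<open>Maximality passes to subsets, which gives contraction. For expansion, the points that
  \<open>x\<close> weakly beats form a convex set containing \<open>X\<close> and \<open>Y\<close>,
  hence also the hull of their union.\<close>

lemma max_set_consistent:
  assumes R: "preference_relation R" "convex_pref R" and S: "\<forall>X\<in>feasible. S X = max_set R X"
  shows "consistent S"
  unfolding consistent_def contraction_def expansion_def
proof (intro conjI ballI impI subsetI)
  fix X Y x assume "X \<in> feasible" "Y \<in> feasible" "X \<inter> Y \<noteq> {}" "x \<in> S X \<inter> Y"
  moreover have "X \<inter> Y \<in> feasible"
    using calculation unfolding feasible_def by (auto intro: compact_Int convex_Int)
  ultimately show "x \<in> S (X \<inter> Y)" using S by (auto simp: max_set_def)
next
  fix X Y x assume X: "X \<in> feasible" and Y: "Y \<in> feasible" and "x \<in> S X \<inter> S Y"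
  then have x: "x \<in> X" "\<forall>y\<in>X \<union> Y. weak_pref R x y" using S by (auto simp: max_set_def)
  have D: "X \<subseteq> prob_simplex" "Y \<subseteq> prob_simplex" "compact X" "compact Y"
    using X Y unfolding feasible_def by auto
  let ?L = "lower_set R x \<union> indiff_set R x"
  have "convex hull (X \<union> Y) \<subseteq> ?L"
  proof (rule hull_minimal)
    show "X \<union> Y \<subseteq> ?L" using x D unfolding lower_set_def indiff_set_def weak_pref_def by blast
    show "convex ?L" using R x D unfolding convex_pref_def by blast
  qed
  then have "\<forall>y\<in>convex hull (X \<union> Y). weak_pref R x y"
    unfolding lower_set_def indiff_set_def weak_pref_def by blast
  moreover have "convex hull (X \<union> Y) \<subseteq> prob_simplex" "compact (convex hull (X \<union> Y))"
    using hull_minimal[of "X \<union> Y" prob_simplex convex] compact_convex_hull[OF compact_Un]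
      D convex_prob_simplex by blast+
  then have "convex hull (X \<union> Y) \<in> feasible" using x unfolding feasible_def by auto
  moreover have "x \<in> convex hull (X \<union> Y)" using x by (simp add: hull_inc)
  ultimately show "x \<in> S (convex hull (X \<union> Y))" using S by (auto simp: max_set_def)
qed

theorem proposition2:
  fixes S :: "(real ^ 'u::finite) set \<Rightarrow> (real ^ 'u) set"
  assumes "choice_function S"
  shows "(\<exists>R. preference_relation R \<and> continuous_pref R \<and> convex_pref R \<and>
              (\<forall>X\<in>feasible. S X = max_set R X))
         \<longleftrightarrow> consistent S"
proof
  assume "consistent S"
  then interpret consistent_choice S using assms by unfold_locales
  show "\<exists>R. preference_relation R \<and> continuous_pref R \<and> convex_pref R \<and> (\<forall>X\<in>feasible. S X = max_set R X)"
    using preference_relation_R continuous_R convex_R choice_eq_max_set by blast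
qed (use max_set_consistent in blast)

end
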